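(* Let $\mathcal{G}$ be a strongly connected and weight-balanced weighted digraph with $n$ vertices and Laplacian $\mathsf{L}\in\mathbb{R}^{n\times n}$, and let $\mathbf{L}=\mathsf{L}\otimes\mathsf{I}_d\in\mathbb{R}^{nd\times nd}$. For each $i\in\{1,\dots,n\}$ let $f^i:\mathbb{R}^d\to\mathbb{R}$ be locally Lipschitz and convex, and let $\tilde f(\boldsymbol{x})=\sum_{i=1}^n f^i(x^i)$ for $\boldsymbol{x}=(x^1,\dots,x^n)\in(\mathbb{R}^d)^n$. Define $F:\mathbb{R}^{nd}\times\mathbb{R}^{nd}\to\mathbb{R}$ by $$F(\boldsymbol{x},\boldsymbol{z})=\tilde f(\boldsymbol{x})+\boldsymbol{x}^T\mathbf{L}\boldsymbol{z}+\tfrac12\boldsymbol{x}^T\mathbf{L}\boldsymbol{x}.$$ Consider the problem $$(P)\qquad\text{minimize } \tilde f(\boldsymbol{x})\quad\text{subject to}\quad\mathbf{L}\boldsymbol{x}=\mathbf{0}_{nd}.$$ Then $F$ is locally Lipschitz and convex in its first argument and linear in its second, and (i) if $(\boldsymbol{x}^*,\boldsymbol{z}^* )$ is a saddle point of $F$, then so is $(\boldsymbol{x}^*,\boldsymbol{z}^*+\mathbf{1}_n\otimes a)$ for any $a\in\mathbb{R}^d$; (ii) if $(\boldsymbol{x}^*,\boldsymbol{z}^* )$ is a saddle point of $F$, then $\boldsymbol{x}^*$ is a solution of $(P)$; (iii) if $\boldsymbol{x}^*$ is a solution of $(P)$, then there exists $\boldsymbol{z}^*$ with $\mathbf{L}\boldsymbol{z}^*\in-\partial\tilde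 f(\boldsymbol{x}^* )$ such that $(\boldsymbol{x}^*,\boldsymbol{z}^* )$ is a saddle point of $F$.
   Context: A weighted digraph is $\mathcal{G}=(\mathcal{V},\mathcal{E},\mathsf{A})$ with finite vertex set $\mathcal{V}=\{v_1,\dots,v_n\}$, edge set $\mathcal{E}\subseteq\mathcal{V}\times\mathcal{V}$, and adjacency matrix $\mathsf{A}=(a_{ij})\in\mathbb{R}_{\ge0}^{n\times n}$ with $a_{ij}>0$ if $(v_i,v_j)\in\mathcal{E}$ and $a_{ij}=0$ otherwise. Its Laplacian is $\mathsf{L}=\mathsf{D}_{\mathrm{out}}-\mathsf{A}$, where $\mathsf{D}_{\mathrm{out}}$ is the diagonal matrix with entries $\sum_{j}a_{ij}$. It is strongly connected if there is a directed path between any ordered pair of distinct vertices, and weight-balanced if $\sum_j a_{ij}=\sum_j a_{ji}$ for every $i$. $\mathsf{I}_d$ is the $d\times d$ identity matrix, $\mathbf{1}_n=(1,\dots,1)^T\in\mathbb{R}^n$, $\otimes$ the Kronecker product. $\partial\tilde f(\boldsymbol{x})$ is the (Clarke) generalized gradient of $\tilde f$ (for convex functions, the usual subdifferential). Since $F$ is convex in $\boldsymbol{x}$ and linear in $\boldsymbol{z}$, a saddle point $(\boldsymbol{x}^*,\boldsymbol{z}^* )$ of $F$ is a point with $F(\boldsymbol{x}^*,\boldsymbol{z})\le F(\boldsymbol{x}^*,\boldsymbol{z}^* )\le F(\boldsymbol{x},\boldsymbol{z}^* )$ for all $\boldsymbol{x},\boldsymbol{z}\in\mathbb{R}^{nd}$.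 *)

theory Defs
  imports "HOL-Analysis.Analysis"
begin

text \<open>The vertex set is all of the finite type \<^typ>\<open>'n\<close>, and loops are not excluded.\<close>

definition weighted_digraph :: "('n::finite \<times> 'n) set \<Rightarrow> real^'n^'n \<Rightarrow> bool" where
  "weighted_digraph E A \<longleftrightarrow>
     (\<forall>i j. if (i, j) \<in> E then A $ i $ j > 0 else A $ i $ j = 0)"

definition strongly_connected :: "('n \<times> 'n) set \<Rightarrow> bool" where
  "strongly_connected E \<longleftrightarrow> (\<forall>i j. i \<noteq> j \<longrightarrow> (i, j) \<in> E\<^sup>+)"

definition weight_balanced :: "real^'n^'n \<Rightarrow> bool" where
  "weight_balanced A \<longleftrightarrow> (\<forall>i. (\<Sum>j\<in>UNIV. A $ i $ j) = (\<Sum>j\<in>UNIV. A $ j $ i))"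

definition out_degree_matrix :: "real^'n^'n \<Rightarrow> real^'n^'n" where
  "out_degree_matrix A = (\<chi> i j. if i = j then \<Sum>k\<in>UNIV. A $ i $ k else 0)"

definition laplacian :: "real^'n^'n \<Rightarrow> real^'n^'n" where
  "laplacian A = out_degree_matrix A - A"

text \<open>The space \<open>\<real>\<^sup>n\<^sup>d\<close> is indexed by pairs: entry \<open>(i, k)\<close> of \<open>x\<close> is the \<open>k\<close>-th
  coordinate of the block \<open>x\<^sup>i\<close>.\<close>

definition kronecker_product ::
  "real^'n::finite^'m::finite \<Rightarrow> real^'q::finite^'p::finite \<Rightarrow> real^('n \<times> 'q)^('m \<times> 'p)" (infixr \<open>\<otimes>\<^sub>M\<close> 75) where
  "A \<otimes>\<^sub>M B = (\<chi> r c. A $ fst r $ fst c * B $ snd r $ snd c)"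

definition kronecker_vector ::
  "real^'n::finite \<Rightarrow> real^'d::finite \<Rightarrow> real^('n \<times> 'd)" (infixr \<open>\<otimes>\<^sub>V\<close> 75) where
  "u \<otimes>\<^sub>V a = (\<chi> r. u $ fst r * a $ snd r)"

definition block :: "real^('n::finite \<times> 'd::finite) \<Rightarrow> 'n \<Rightarrow> real^'d" where
  "block x i = (\<chi> k. x $ (i, k))"

definition bold_laplacian :: "real^'n^'n::finite \<Rightarrow> real^('n \<times> 'd::finite)^('n \<times> 'd)" where
  "bold_laplacian A = laplacian A \<otimes>\<^sub>M mat 1"

definition total_cost :: "('n::finite \<Rightarrow> real^'d::finite \<Rightarrow> real) \<Rightarrow> real^('n \<times> 'd) \<Rightarrow> real" where
  "total_cost f x = (\<Sum>i\<in>UNIV. f i (block x i))"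

definition saddle_function ::
  "real^'n^'n \<Rightarrow> ('n::finite \<Rightarrow> real^'d::finite \<Rightarrow> real) \<Rightarrow> real^('n \<times> 'd) \<Rightarrow> real^('n \<times> 'd) \<Rightarrow> real" where
  "saddle_function A f x z =
     total_cost f x + x \<bullet> (bold_laplacian A *v z) + 1/2 * (x \<bullet> (bold_laplacian A *v x))"

definition solves_problem ::
  "real^'n^'n \<Rightarrow> ('n::finite \<Rightarrow> real^'d::finite \<Rightarrow> real) \<Rightarrow> real^('n \<times> 'd) \<Rightarrow> bool" where
  "solves_problem A f xs \<longleftrightarrow> is_arg_min (total_cost f) (\<lambda>x. bold_laplacian A *v x = 0) xs"

definition saddle_point :: "('a \<Rightarrow> 'b \<Rightarrow> real) \<Rightarrow> 'a \<Rightarrow> 'b \<Rightarrow> bool" where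
  "saddle_point F xs zs \<longleftrightarrow> (\<forall>x z. F xs z \<le> F xs zs \<and> F xs zs \<le> F x zs)"

text \<open>The library's \<^const>\<open>local_lipschitz\<close> is about families of functions depending on a
  parameter; this is the notion for a single function.\<close>

definition locally_lipschitz :: "('a::metric_space \<Rightarrow> 'b::metric_space) \<Rightarrow> bool" where
  "locally_lipschitz f \<longleftrightarrow> (\<forall>x. \<exists>e>0. \<exists>C. lipschitz_on C (ball x e) f)"

text \<open>Linearity of \<open>F\<close> in \<open>z\<close> is meant up to the constant \<open>F(x, 0)\<close>, which is nonzero in
  general: for fixed \<open>x\<close>, a linear map plus a constant.\<close>

definition affine_function :: "('a::real_vector \<Rightarrow> 'b::real_vector) \<Rightarrow> bool" where
  "affine_function g \<longleftrightarrow> linear (\<lambda>z. g z - g 0)"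

text \<open>Clarke's generalized directional derivative, the upper limit of
  \<open>(f (y + t v) - f y) / t\<close> as \<open>y \<rightarrow> x\<close> (including \<open>y = x\<close>) and \<open>t \<rightarrow> 0\<close> from above,
  and the generalized gradient it supports.\<close>

definition clarke_derivative :: "('a::real_inner \<Rightarrow> real) \<Rightarrow> 'a \<Rightarrow> 'a \<Rightarrow> ereal" where
  "clarke_derivative f x v =
     Limsup (nhds x \<times>\<^sub>F at_right 0) (\<lambda>(y, t). ereal ((f (y + t *\<^sub>R v) - f y) / t))"

definition generalized_gradient :: "('a::real_inner \<Rightarrow> real) \<Rightarrow> 'a \<Rightarrow> 'a set" where
  "generalized_gradient f x = {g. \<forall>v. ereal (g \<bullet> v) \<le> clarke_derivative f x v}"

lemma locally_lipschitz_imp_isCont: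
  assumes "locally_lipschitz f"
  shows "isCont f x"
proof -
  obtain e C where e: "e > 0" and C: "lipschitz_on C (ball x e) f"
    using assms unfolding locally_lipschitz_def by blast
  have "continuous_on (ball x e) f"
    by (rule lipschitz_on_continuous_on[OF C])
  then show ?thesis
    using e by (simp add: continuous_on_eq_continuous_at)
qed

lemma convex_difference_quotient_le:
  fixes f :: "'a::real_vector \<Rightarrow> real"
  assumes "convex_on UNIV f" "0 < t" "t \<le> 1"
  shows "(f (y + t *\<^sub>R v) - f y) / t \<le> f (y + v) - f y"
proof -
  have "f ((1 - t) *\<^sub>R y + t *\<^sub>R (y + v)) \<le> (1 - t) * f y + t * f (y + v)"
    using assms convex_onD[OF assms(1), of t y "y + v"] by auto
  moreover have "(1 - t) *\<^sub>R y + t *\<^sub>R (y + v) = y + t *\<^sub>R v"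
    by (simp add: algebra_simps)
  ultimately have "f (y + t *\<^sub>R v) - f y \<le> t * (f (y + v) - f y)"
    by (simp add: algebra_simps)
  then show ?thesis
    using assms(2) by (simp add: divide_le_eq mult.commute)
qed

lemma generalized_gradient_convex:
  fixes f :: "'a::real_inner \<Rightarrow> real"
  assumes conv: "convex_on UNIV f" and lip: "locally_lipschitz f"
  shows "generalized_gradient f x = {g. \<forall>y. f y \<ge> f x + g \<bullet> (y - x)}"
proof (intro set_eqI iffI)
  fix g assume g: "g \<in> generalized_gradient f x"
  let ?q = "\<lambda>v. \<lambda>(y, t). ereal ((f (y + t *\<^sub>R v) - f y) / t)"
  have "f y \<ge> f x + g \<bullet> (y - x)" for y
  proof -
    define v where "v = y - x"
    have *: "g \<bullet> v \<le> c" if c: "f (x + v) - f x < c" for c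
    proof -
      have "((\<lambda>z. f (z + v) - f z) \<longlongrightarrow> f (x + v) - f x) (nhds x)"
      proof -
        have 1: "(f \<longlongrightarrow> f x) (nhds x)" "(f \<longlongrightarrow> f (x + v)) (nhds (x + v))"
          using locally_lipschitz_imp_isCont[OF lip]
          by (auto simp: isCont_def tendsto_at_iff_tendsto_nhds)
        have "((\<lambda>z. z + v) \<longlongrightarrow> x + v) (nhds x)"
          by (intro tendsto_intros) (simp add: filterlim_ident)
        then have "((\<lambda>z. f (z + v)) \<longlongrightarrow> f (x + v)) (nhds x)"
          by (rule filterlim_compose[OF 1(2)])
        then show ?thesis
          by (intro tendsto_diff 1)
      qed
      then have e1: "eventually (\<lambda>z. f (z + v) - f z < c) (nhds x)"
        using c by (rule order_tendstoD)
      have e2: "eventually (\<lambda>t::real. 0 < t \<and> t \<le> 1) (at_right 0)"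
        unfolding eventually_at_right_field by (rule exI[of _ 1]) auto
      have "eventually (\<lambda>p. ?q v p \<le> ereal c) (nhds x \<times>\<^sub>F at_right 0)"
      proof (rule eventually_mono[OF eventually_prodI[OF e1 e2]])
        fix p :: "'a \<times> real"
        assume p: "f (fst p + v) - f (fst p) < c \<and> 0 < snd p \<and> snd p \<le> 1"
        then have "(f (fst p + snd p *\<^sub>R v) - f (fst p)) / snd p \<le> f (fst p + v) - f (fst p)"
          by (intro convex_difference_quotient_le[OF conv]) auto
        with p have "(f (fst p + snd p *\<^sub>R v) - f (fst p)) / snd p \<le> c"
          by linarith
        then show "?q v p \<le> ereal c"
          by (simp add: case_prod_beta)
      qed
      then have "clarke_derivative f x v \<le> ereal c"
        unfolding clarke_derivative_def by (rule Limsup_bounded)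
      moreover have "ereal (g \<bullet> v) \<le> clarke_derivative f x v"
        using g by (simp add: generalized_gradient_def)
      ultimately show ?thesis
        using order_trans ereal_less_eq(3) by blast
    qed
    have "g \<bullet> v \<le> f (x + v) - f x"
      by (rule dense_ge) (rule *)
    then show ?thesis
      by (simp add: v_def)
  qed
  then show "g \<in> {g. \<forall>y. f y \<ge> f x + g \<bullet> (y - x)}"
    by simp
next
  fix g assume g: "g \<in> {g. \<forall>y. f y \<ge> f x + g \<bullet> (y - x)}"
  have "ereal (g \<bullet> v) \<le> clarke_derivative f x v" for v
    unfolding clarke_derivative_def Limsup_def
  proof (rule INF_greatest)
    fix P :: "'a \<times> real \<Rightarrow> bool"
    assume "P \<in> {P. eventually P (nhds x \<times>\<^sub>F at_right 0)}"
    then obtain Q R where Q: "eventually Q (nhds x)" and R: "eventually R (at_right (0::real))"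
      and QR: "\<And>y t. Q y \<Longrightarrow> R t \<Longrightarrow> P (y, t)"
      unfolding eventually_prod_filter by auto
    have "eventually (\<lambda>t. R t \<and> 0 < t) (at_right (0::real))"
      using R eventually_at_right_less[of 0] by (rule eventually_conj)
    then obtain t where t: "R t" "0 < t"
      using eventually_happens'[OF trivial_limit_at_right_real] by blast
    have "P (x, t)"
      using QR t(1) eventually_nhds_x_imp_x[OF Q] by blast
    moreover have "g \<bullet> v \<le> (f (x + t *\<^sub>R v) - f x) / t"
    proof -
      have "f (x + t *\<^sub>R v) \<ge> f x + g \<bullet> (x + t *\<^sub>R v - x)"
        using g by blast
      then show ?thesis
        using t(2) by (simp add: le_divide_eq mult.commute)
    qed
    ultimately show "ereal (g \<bullet> v) \<le>
        (SUP p\<in>{p. P p}. case p of (y, t) \<Rightarrow> ereal ((f (y + t *\<^sub>R v) - f y) / t))"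
      by (intro SUP_upper2[of "(x, t)"]) auto
  qed
  then show "g \<in> generalized_gradient f x"
    by (simp add: generalized_gradient_def)
qed

end

theory Submission
  imports Defs
begin

text \<open>
  Because the digraph is weight-balanced, the quadratic form of the Laplacian is a sum of squares,
  \<open>x \<bullet> L x = 1/2 \<Sum>i j. a\<^sub>i\<^sub>j \<parallel>x\<^sup>i - x\<^sup>j\<parallel>\<^sup>2\<close> (lemma \<open>inner_bold_laplacian_self\<close>).  It is therefore
  nonnegative, which makes \<open>F\<close> convex in \<open>x\<close>, and by strong connectivity it vanishes only on the
  consensus space \<open>S = {1 \<otimes> a}\<close> (lemma \<open>consensus_of_quadratic_form_zero\<close>).  Weight balance also
  gives \<open>x \<bullet> L z = 0\<close> for all \<open>x \<in> S\<close>, so that \<open>S\<close> is the kernel both of \<open>L\<close> and of its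
  transpose, and the range of \<open>L\<close> is the orthogonal complement of \<open>S\<close>
  (lemma \<open>orthogonal_consensus_in_range\<close>).

  Adding \<open>1 \<otimes> a\<close> to \<open>z\<close> does not change \<open>L z\<close>, hence not \<open>F\<close>; this is (i).  At a saddle point, the
  maximality of \<open>F(x, \<cdot>)\<close>, which is affine in \<open>z\<close>, forces \<open>x \<bullet> L w = 0\<close> for all \<open>w\<close>; taking
  \<open>w = x\<close> puts \<open>x\<close> into \<open>S\<close>.  Since \<open>F(\<cdot>, z)\<close> agrees with the total cost on \<open>S\<close>, the minimality
  of \<open>F(\<cdot>, z)\<close> at \<open>x\<close> gives (ii).

  For (iii), a solution of the problem minimizes a convex function over the subspace \<open>S\<close>, and a
  separation argument (lemma \<open>subgradient_orthogonal_to_subspace\<close>) yields a subgradient \<open>g\<close> there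
  that is orthogonal to \<open>S\<close>.  So \<open>-g = L z\<close> for some \<open>z\<close>, and the subgradient inequality for \<open>g\<close>
  together with the nonnegativity of the quadratic form is the saddle inequality in \<open>x\<close>; the one
  in \<open>z\<close> is an equality.
\<close>

section \<open>Locally Lipschitz functions\<close>

lemma locally_lipschitz_compose:
  assumes g: "locally_lipschitz g" and f: "locally_lipschitz f"
  shows "locally_lipschitz (\<lambda>x. g (f x))"
  unfolding locally_lipschitz_def
proof
  fix x
  obtain e C where e: "e > 0" "lipschitz_on C (ball x e) f"
    using f unfolding locally_lipschitz_def by blast
  obtain r D where r: "r > 0" "lipschitz_on D (ball (f x) r) g"
    using g unfolding locally_lipschitz_def by blast
  have "continuous_on (ball x e) f"
    by (rule lipschitz_on_continuous_on[OF e(2)])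
  then have "isCont f x"
    using e(1) by (simp add: continuous_on_eq_continuous_at)
  then obtain s where s: "s > 0" "f ` ball x s \<subseteq> ball (f x) r"
    using r(1) unfolding continuous_at_ball by blast
  have "lipschitz_on C (ball x (min e s)) f"
    by (rule lipschitz_on_subset[OF e(2)]) auto
  moreover have "lipschitz_on D (f ` ball x (min e s)) g"
    by (rule lipschitz_on_subset[OF r(2)]) (use s(2) in auto)
  ultimately have "lipschitz_on (D * C) (ball x (min e s)) (\<lambda>x. g (f x))"
    by (rule lipschitz_on_compose2)
  then show "\<exists>e>0. \<exists>C. lipschitz_on C (ball x e) (\<lambda>x. g (f x))"
    using e(1) s(1) by (intro exI[of _ "min e s"]) auto
qed

lemma locally_lipschitz_add:
  fixes f g :: "'a::metric_space \<Rightarrow> 'b::real_normed_vector"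
  assumes f: "locally_lipschitz f" and g: "locally_lipschitz g"
  shows "locally_lipschitz (\<lambda>x. f x + g x)"
  unfolding locally_lipschitz_def
proof
  fix x
  obtain e C where e: "e > 0" "lipschitz_on C (ball x e) f"
    using f unfolding locally_lipschitz_def by blast
  obtain r D where r: "r > 0" "lipschitz_on D (ball x r) g"
    using g unfolding locally_lipschitz_def by blast
  have "lipschitz_on (C + D) (ball x (min e r)) (\<lambda>x. f x + g x)"
    by (intro lipschitz_on_add lipschitz_on_subset[OF e(2)] lipschitz_on_subset[OF r(2)]) auto
  then show "\<exists>e>0. \<exists>C. lipschitz_on C (ball x e) (\<lambda>x. f x + g x)"
    using e(1) r(1) by (intro exI[of _ "min e r"]) auto
qed

lemma locally_lipschitz_const: "locally_lipschitz (\<lambda>_. c)"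
  unfolding locally_lipschitz_def
  using lipschitz_on_constant zero_less_one by blast

lemma locally_lipschitz_sum:
  fixes f :: "'i \<Rightarrow> 'a::metric_space \<Rightarrow> 'b::real_normed_vector"
  assumes "\<And>i. i \<in> I \<Longrightarrow> locally_lipschitz (f i)"
  shows "locally_lipschitz (\<lambda>x. \<Sum>i\<in>I. f i x)"
  using assms
  by (induction I rule: infinite_finite_induct)
     (auto intro: locally_lipschitz_const locally_lipschitz_add)

lemma locally_lipschitz_bounded_linear:
  assumes "bounded_linear h"
  shows "locally_lipschitz h"
  unfolding locally_lipschitz_def
proof
  fix x
  obtain C where "lipschitz_on C (ball x 1) h"
    using bounded_linear.lipschitz_boundE[OF assms] by blast
  then show "\<exists>e>0. \<exists>C. lipschitz_on C (ball x e) h"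
    using zero_less_one by blast
qed

lemma locally_lipschitz_bounded_bilinear:
  assumes "bounded_bilinear B"
  shows "locally_lipschitz (\<lambda>(x, z). B x z)"
  unfolding locally_lipschitz_def
proof
  interpret B: bounded_bilinear B by fact
  fix p :: "'a \<times> 'b"
  obtain K where K: "K > 0" "\<And>x z. norm (B x z) \<le> norm x * norm z * K"
    using B.pos_bounded by blast
  define R where "R = norm p + 1"
  have R: "norm q \<le> R" if "q \<in> ball p 1" for q
    using that norm_triangle_sub[of q p] by (simp add: R_def dist_norm norm_minus_commute)
  have "lipschitz_on (2 * R * K) (ball p 1) (\<lambda>(x, z). B x z)"
  proof (rule lipschitz_onI)
    show "0 \<le> 2 * R * K"
      using K(1) by (simp add: R_def)
  next
    fix q q' assume q: "q \<in> ball p 1" "q' \<in> ball p 1"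
    obtain x z x' z' where eq: "q = (x, z)" "q' = (x', z')"
      by (cases q, cases q')
    have n: "norm x \<le> R" "norm z' \<le> R"
      using R[OF q(1)] R[OF q(2)] norm_fst_le[of x z] norm_snd_le[of z' x'] unfolding eq
      by linarith+
    have d: "norm (z - z') \<le> dist q q'" "norm (x - x') \<le> dist q q'"
      using dist_fst_le[of q q'] dist_snd_le[of q q'] by (auto simp: eq dist_norm)
    have "B x z - B x' z' = B x (z - z') + B (x - x') z'"
      by (simp add: B.diff_left B.diff_right)
    then have "norm (B x z - B x' z') \<le> norm (B x (z - z')) + norm (B (x - x') z')"
      by (metis norm_triangle_ineq)
    also have "\<dots> \<le> norm x * norm (z - z') * K + norm (x - x') * norm z' * K"
      by (intro add_mono K)
    also have "\<dots> \<le> R * dist q q' * K + dist q q' * R * K"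
      using K(1) n d by (intro add_mono mult_mono) (auto simp: R_def)
    finally show "dist (case q of (x, z) \<Rightarrow> B x z) (case q' of (x, z) \<Rightarrow> B x z)
        \<le> 2 * R * K * dist q q'"
      by (simp add: eq dist_norm algebra_simps)
  qed
  then show "\<exists>e>0. \<exists>C. lipschitz_on C (ball p e) (\<lambda>(x, z). B x z)"
    using zero_less_one by blast
qed

section \<open>Convexity of quadratic forms and subgradients at constrained minimizers\<close>

lemma convex_on_quadratic_form:
  assumes B: "bounded_bilinear B" and nonneg: "\<And>x. B x x \<ge> (0::real)"
  shows "convex_on UNIV (\<lambda>x. B x x)"
proof (rule convex_onI)
  interpret B: bounded_bilinear B by fact
  fix t :: real and x y assume t: "0 < t" "t < 1"
  have "B ((1 - t) *\<^sub>R x + t *\<^sub>R y) ((1 - t) *\<^sub>R x + t *\<^sub>R y)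
      = (1 - t) * B x x + t * B y y - t * (1 - t) * B (x - y) (x - y)"
    by (simp add: B.add_left B.add_right B.diff_left B.diff_right B.scaleR_left B.scaleR_right
        algebra_simps)
  moreover have "0 \<le> t * (1 - t) * B (x - y) (x - y)"
    using t nonneg by simp
  ultimately show "B ((1 - t) *\<^sub>R x + t *\<^sub>R y) ((1 - t) *\<^sub>R x + t *\<^sub>R y)
      \<le> (1 - t) * B x x + t * B y y"
    by linarith
qed simp

text \<open>Separate the strict epigraph of \<open>v \<mapsto> \<phi> (x + v) - \<phi> x\<close> from \<open>S \<times> {0}\<close>.  A functional bounded
  above on a subspace vanishes on it, so the separating functional vanishes on \<open>S \<times> {0}\<close>.  The
  separating hyperplane is not vertical because \<open>\<phi>\<close> is finite everywhere, and its slope is the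
  subgradient.\<close>

lemma subgradient_orthogonal_to_subspace:
  fixes \<phi> :: "'a::euclidean_space \<Rightarrow> real"
  assumes conv: "convex_on UNIV \<phi>" and S: "subspace S"
    and min: "\<And>s. s \<in> S \<Longrightarrow> \<phi> x \<le> \<phi> (x + s)"
  obtains g where "\<And>s. s \<in> S \<Longrightarrow> g \<bullet> s = 0" "\<And>y. \<phi> y \<ge> \<phi> x + g \<bullet> (y - x)"
proof -
  define C where "C = {(v, r). \<phi> (x + v) - \<phi> x < r}"
  define D where "D = S \<times> {0::real}"
  have "convex C"
  proof (rule convexI)
    fix p q :: "'a \<times> real" and a b :: real
    assume pq: "p \<in> C" "q \<in> C" and ab: "0 \<le> a" "0 \<le> b" "a + b = 1"
    obtain v r w s where eq: "p = (v, r)" "q = (w, s)"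
      by (cases p, cases q)
    have vw: "\<phi> (x + v) - \<phi> x < r" "\<phi> (x + w) - \<phi> x < s"
      using pq by (auto simp: C_def eq)
    have "a *\<^sub>R (x + v) + b *\<^sub>R (x + w) = (a + b) *\<^sub>R x + (a *\<^sub>R v + b *\<^sub>R w)"
      by (simp add: algebra_simps)
    moreover have "\<phi> (a *\<^sub>R (x + v) + b *\<^sub>R (x + w)) \<le> a * \<phi> (x + v) + b * \<phi> (x + w)"
      using conv ab unfolding convex_on_def by blast
    ultimately have "\<phi> (x + (a *\<^sub>R v + b *\<^sub>R w)) \<le> a * \<phi> (x + v) + b * \<phi> (x + w)"
      using ab(3) by simp
    moreover have "a * (\<phi> (x + v) - \<phi> x) + b * (\<phi> (x + w) - \<phi> x) < a * r + b * s"
    proof (cases "a = 0")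
      case True
      then show ?thesis using ab vw by simp
    next
      case False
      then show ?thesis using ab vw
        by (intro add_less_le_mono mult_strict_left_mono mult_left_mono) auto
    qed
    moreover have "a * \<phi> x + b * \<phi> x = \<phi> x"
      using ab(3) by (metis distrib_right mult_1)
    ultimately have "\<phi> (x + (a *\<^sub>R v + b *\<^sub>R w)) - \<phi> x < a * r + b * s"
      by (simp add: right_diff_distrib)
    then show "a *\<^sub>R p + b *\<^sub>R q \<in> C"
      by (simp add: C_def eq)
  qed
  moreover have "convex D"
    unfolding D_def using S by (intro convex_Times subspace_imp_convex) auto
  moreover have "(0, 0) \<in> D"
    using S by (simp add: D_def subspace_0)
  moreover have "(0, 1) \<in> C"
    by (simp add: C_def)
  moreover have "D \<inter> C = {}"
    using min by (fastforce simp: C_def D_def)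
  ultimately obtain p b where p: "p \<noteq> 0" "\<And>q. q \<in> D \<Longrightarrow> p \<bullet> q \<le> b" "\<And>q. q \<in> C \<Longrightarrow> p \<bullet> q \<ge> b"
    using separating_hyperplane_sets[of D C] by blast
  obtain h \<alpha> where h: "p = (h, \<alpha>)"
    by (cases p)
  have b: "0 \<le> b"
    using p(2)[OF \<open>(0, 0) \<in> D\<close>] by (simp add: h)
  have perp: "h \<bullet> s = 0" if s: "s \<in> S" for s
  proof (rule ccontr)
    assume ne: "h \<bullet> s \<noteq> 0"
    \<comment> \<open>scaled so that the functional takes the value \<open>b + 1\<close>\<close>
    have "(((b + 1) / (h \<bullet> s)) *\<^sub>R s, 0) \<in> D"
      using s S by (simp add: D_def subspace_scale)
    from p(2)[OF this] ne show False
      by (simp add: h)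
  qed
  have above: "0 \<le> h \<bullet> v + \<alpha> * r" if "\<phi> (x + v) - \<phi> x < r" for v r
    using p(3)[of "(v, r)"] that b by (simp add: C_def h)
  have "0 \<le> \<alpha>"
    using above[of 0 1] by simp
  moreover have "\<alpha> \<noteq> 0"
  proof
    assume "\<alpha> = 0"
    then have "0 \<le> h \<bullet> (- h)"
      using above[of "- h" "\<phi> (x + (- h)) - \<phi> x + 1"] by simp
    then have "h = 0"
      by (metis inner_minus_right inner_gt_zero_iff neg_0_le_iff_le not_less)
    with \<open>\<alpha> = 0\<close> p(1) show False
      by (simp add: h zero_prod_def)
  qed
  ultimately have \<alpha>: "0 < \<alpha>" by simp
  define g where "g = (- 1 / \<alpha>) *\<^sub>R h"
  show ?thesis
  proof
    show "g \<bullet> s = 0" if "s \<in> S" for s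
      using perp[OF that] by (simp add: g_def)
    show "\<phi> y \<ge> \<phi> x + g \<bullet> (y - x)" for y
    proof -
      have "g \<bullet> (y - x) \<le> \<phi> y - \<phi> x"
      proof (rule dense_ge)
        fix r assume "\<phi> y - \<phi> x < r"
        then have "0 \<le> h \<bullet> (y - x) + \<alpha> * r"
          using above[of "y - x" r] by simp
        then show "g \<bullet> (y - x) \<le> r"
          using \<alpha> by (simp add: g_def field_simps)
      qed
      then show ?thesis by simp
    qed
  qed
qed

section \<open>The Laplacian and the consensus space\<close>

definition consensus :: "(real^('n::finite \<times> 'd::finite)) set" where
  "consensus = range (\<lambda>a. (1::real^'n) \<otimes>\<^sub>V (a::real^'d))"

lemma mem_consensus_iff:
  "x \<in> consensus \<longleftrightarrow> (\<forall>i j k. x $ (i, k) = x $ (j, k))"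
proof
  assume "x \<in> consensus"
  then show "\<forall>i j k. x $ (i, k) = x $ (j, k)"
    by (auto simp: consensus_def kronecker_vector_def)
next
  assume eq: "\<forall>i j k. x $ (i, k) = x $ (j, k)"
  have "x = 1 \<otimes>\<^sub>V (\<chi> k. x $ (undefined, k))"
    using eq by (auto simp: vec_eq_iff kronecker_vector_def)
  then show "x \<in> consensus"
    unfolding consensus_def by blast
qed

lemma subspace_consensus: "subspace consensus"
proof (rule subspaceI)
  show "x + y \<in> consensus" if "x \<in> consensus" "y \<in> consensus" for x y
    using that unfolding mem_consensus_iff vector_add_component by metis
  show "c *\<^sub>R x \<in> consensus" if "x \<in> consensus" for c x
    using that unfolding mem_consensus_iff vector_scaleR_component by metis
qed (simp add: mem_consensus_iff)

lemma bold_laplacian_nth: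
  fixes x :: "real^('n::finite \<times> 'd::finite)"
  shows "(bold_laplacian A *v x) $ (i, k) = (\<Sum>j\<in>UNIV. A $ i $ j * (x $ (i, k) - x $ (j, k)))"
proof -
  have "(bold_laplacian A *v x) $ (i, k)
      = (\<Sum>j\<in>UNIV. \<Sum>l\<in>UNIV. laplacian A $ i $ j * (if k = l then 1 else 0) * x $ (j, l))"
    by (simp add: bold_laplacian_def matrix_vector_mult_def kronecker_product_def mat_def
        sum.cartesian_product case_prod_beta)
  also have "\<dots> = (\<Sum>j\<in>UNIV. laplacian A $ i $ j * x $ (j, k))"
    by (simp add: if_distrib if_distribR cong: if_cong)
  also have "\<dots> = (\<Sum>j\<in>UNIV. (if i = j then (\<Sum>m\<in>UNIV. A $ i $ m) * x $ (i, k) else 0)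
      - A $ i $ j * x $ (j, k))"
    by (rule sum.cong) (auto simp: laplacian_def out_degree_matrix_def algebra_simps)
  also have "\<dots> = (\<Sum>j\<in>UNIV. A $ i $ j * (x $ (i, k) - x $ (j, k)))"
    by (simp add: sum_subtractf right_diff_distrib sum_distrib_right)
  finally show ?thesis .
qed

lemma bold_laplacian_consensus:
  assumes "x \<in> consensus"
  shows "bold_laplacian A *v x = 0"
proof -
  have "x $ (i, k) - x $ (j, k) = 0" for i j k
    using assms unfolding mem_consensus_iff by (metis diff_self)
  then show ?thesis
    by (simp add: vec_eq_iff bold_laplacian_nth del: right_minus_eq)
qed

lemma inner_bold_laplacian:
  fixes x z :: "real^('n::finite \<times> 'd::finite)"
  shows "x \<bullet> (bold_laplacian A *v z)
    = (\<Sum>k\<in>UNIV. \<Sum>i\<in>UNIV. \<Sum>j\<in>UNIV. A $ i $ j * x $ (i, k) * (z $ (i, k) - z $ (j, k)))"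
proof -
  have "x \<bullet> (bold_laplacian A *v z)
      = (\<Sum>i\<in>UNIV. \<Sum>k\<in>UNIV. x $ (i, k) * (bold_laplacian A *v z) $ (i, k))"
    by (simp add: inner_vec_def sum.cartesian_product case_prod_beta)
  also have "\<dots> = (\<Sum>k\<in>UNIV. \<Sum>i\<in>UNIV. x $ (i, k) * (bold_laplacian A *v z) $ (i, k))"
    by (rule sum.swap)
  also have "\<dots> = (\<Sum>k\<in>UNIV. \<Sum>i\<in>UNIV. \<Sum>j\<in>UNIV.
      A $ i $ j * x $ (i, k) * (z $ (i, k) - z $ (j, k)))"
    by (simp add: bold_laplacian_nth sum_distrib_left mult_ac)
  finally show ?thesis .
qed

lemma weight_balanced_sum:
  fixes A :: "real^'n^'n::finite"
  assumes "weight_balanced A"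
  shows "(\<Sum>i\<in>UNIV. \<Sum>j\<in>UNIV. A $ i $ j * v j) = (\<Sum>i\<in>UNIV. \<Sum>j\<in>UNIV. A $ i $ j * v i)"
proof -
  have "(\<Sum>i\<in>UNIV. \<Sum>j\<in>UNIV. A $ i $ j * v j) = (\<Sum>j\<in>UNIV. (\<Sum>i\<in>UNIV. A $ i $ j) * v j)"
    by (subst sum.swap) (simp add: sum_distrib_right)
  also have "\<dots> = (\<Sum>j\<in>UNIV. (\<Sum>i\<in>UNIV. A $ j $ i) * v j)"
    using assms by (simp add: weight_balanced_def)
  finally show ?thesis
    by (simp add: sum_distrib_right)
qed

text \<open>The columns of a weight-balanced Laplacian sum to zero, so its range is orthogonal to the
  consensus space.\<close>

lemma inner_consensus_bold_laplacian:
  fixes x z :: "real^('n::finite \<times> 'd::finite)"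
  assumes bal: "weight_balanced A" and x: "x \<in> consensus"
  shows "x \<bullet> (bold_laplacian A *v z) = 0"
proof -
  obtain a where a: "\<And>i k. x $ (i, k) = a $ k"
    using x by (auto simp: consensus_def kronecker_vector_def)
  have "(\<Sum>i\<in>UNIV. \<Sum>j\<in>UNIV. A $ i $ j * x $ (i, k) * (z $ (i, k) - z $ (j, k))) = 0" for k
    using weight_balanced_sum[OF bal, of "\<lambda>i. a $ k * z $ (i, k)"]
    by (simp add: a right_diff_distrib sum_subtractf mult.assoc)
  then show ?thesis
    by (simp add: inner_bold_laplacian)
qed

text \<open>Expand the squares: by weight balance, \<open>a\<^sub>i\<^sub>j x\<^sub>i\<^sup>2\<close> and \<open>a\<^sub>i\<^sub>j x\<^sub>j\<^sup>2\<close> have the same sum over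
  all \<open>i\<close> and \<open>j\<close>.\<close>

lemma inner_bold_laplacian_self:
  fixes x :: "real^('n::finite \<times> 'd::finite)"
  assumes bal: "weight_balanced A"
  shows "x \<bullet> (bold_laplacian A *v x)
    = 1/2 * (\<Sum>k\<in>UNIV. \<Sum>i\<in>UNIV. \<Sum>j\<in>UNIV. A $ i $ j * (x $ (i, k) - x $ (j, k))\<^sup>2)"
proof -
  have "(\<Sum>i\<in>UNIV. \<Sum>j\<in>UNIV. A $ i $ j * x $ (i, k) * (x $ (i, k) - x $ (j, k)))
      = 1/2 * (\<Sum>i\<in>UNIV. \<Sum>j\<in>UNIV. A $ i $ j * (x $ (i, k) - x $ (j, k))\<^sup>2)"
    (is "?l = 1/2 * ?r") for k
  proof -
    have "?r = (\<Sum>i\<in>UNIV. \<Sum>j\<in>UNIV. 2 * (A $ i $ j * x $ (i, k) * (x $ (i, k) - x $ (j, k)))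
        + (A $ i $ j * (x $ (j, k))\<^sup>2 - A $ i $ j * (x $ (i, k))\<^sup>2))"
      by (simp add: power2_eq_square algebra_simps)
    also have "\<dots> = 2 * ?l + ((\<Sum>i\<in>UNIV. \<Sum>j\<in>UNIV. A $ i $ j * (x $ (j, k))\<^sup>2)
        - (\<Sum>i\<in>UNIV. \<Sum>j\<in>UNIV. A $ i $ j * (x $ (i, k))\<^sup>2))"
      by (simp only: sum.distrib sum_subtractf sum_distrib_left)
    also have "\<dots> = 2 * ?l"
      using weight_balanced_sum[OF bal, of "\<lambda>i. (x $ (i, k))\<^sup>2"] by simp
    finally show ?thesis by simp
  qed
  then show ?thesis
    by (simp add: inner_bold_laplacian sum_distrib_left)
qed

lemma weighted_digraph_nonneg:
  assumes "weighted_digraph E A"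
  shows "A $ i $ j \<ge> 0"
  using assms unfolding weighted_digraph_def by (metis less_eq_real_def order_refl)

lemma inner_bold_laplacian_nonneg:
  assumes "weighted_digraph E A" and "weight_balanced A"
  shows "x \<bullet> (bold_laplacian A *v x) \<ge> 0"
  using assms weighted_digraph_nonneg[OF assms(1)]
  by (auto simp: inner_bold_laplacian_self intro!: sum_nonneg mult_nonneg_nonneg)

text \<open>If the sum of squares vanishes, the two ends of every edge carry the same vector, and
  strong connectivity transports this equality along directed paths.\<close>

lemma consensus_of_quadratic_form_zero:
  fixes x :: "real^('n::finite \<times> 'd::finite)"
  assumes G: "weighted_digraph E A" and conn: "strongly_connected E" and bal: "weight_balanced A"
    and zero: "x \<bullet> (bold_laplacian A *v x) = 0"
  shows "x \<in> consensus"
proof -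
  have nonneg: "0 \<le> A $ i $ j * (x $ (i, k) - x $ (j, k))\<^sup>2" for i j k
    using weighted_digraph_nonneg[OF G] by simp
  have "(\<Sum>k\<in>UNIV. \<Sum>i\<in>UNIV. \<Sum>j\<in>UNIV. A $ i $ j * (x $ (i, k) - x $ (j, k))\<^sup>2) = 0"
    using zero by (simp add: inner_bold_laplacian_self[OF bal])
  then have "A $ i $ j * (x $ (i, k) - x $ (j, k))\<^sup>2 = 0" for i j k
    by (simp add: sum_nonneg_eq_0_iff sum_nonneg nonneg del: mult_eq_0_iff)
  then have edge: "x $ (i, k) = x $ (j, k)" if "(i, j) \<in> E" for i j k
    using G that unfolding weighted_digraph_def
    by (metis eq_iff_diff_eq_0 less_irrefl mult_eq_0_iff power_eq_0_iff)
  have "x $ (i, k) = x $ (j, k)" if "(i, j) \<in> E\<^sup>+" for i j k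
    using that by (induction rule: trancl_induct) (auto simp: edge)
  then show ?thesis
    using conn unfolding mem_consensus_iff strongly_connected_def by metis
qed

text \<open>The component \<open>w\<close> of \<open>g\<close> orthogonal to the range of \<open>L\<close> satisfies \<open>w \<bullet> L w = 0\<close>, so it
  lies in the consensus space; but there \<open>g\<close> is orthogonal to it, hence \<open>w = 0\<close>.\<close>

lemma orthogonal_consensus_in_range:
  fixes g :: "real^('n::finite \<times> 'd::finite)"
  assumes G: "weighted_digraph E A" and conn: "strongly_connected E" and bal: "weight_balanced A"
    and g: "\<And>s. s \<in> consensus \<Longrightarrow> g \<bullet> s = 0"
  obtains z where "bold_laplacian A *v z = g"
proof -
  let ?R = "range (\<lambda>z. (bold_laplacian A :: real^('n \<times> 'd)^('n \<times> 'd)) *v z)"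
  have "subspace ?R"
    by (intro linear_subspace_image matrix_vector_mul_linear subspace_UNIV)
  then obtain y w where yw: "y \<in> ?R" "\<And>r. r \<in> ?R \<Longrightarrow> orthogonal w r" "g = y + w"
    using orthogonal_subspace_decomp_exists[of ?R g] by (metis span_eq_iff)
  have "w \<bullet> (bold_laplacian A *v w) = 0"
    using yw(2) by (simp add: orthogonal_def)
  then have "w \<in> consensus"
    by (rule consensus_of_quadratic_form_zero[OF G conn bal])
  then have "g \<bullet> w = 0"
    by (rule g)
  moreover have "y \<bullet> w = 0"
    using yw(2)[OF yw(1)] by (simp add: orthogonal_def inner_commute)
  ultimately have "w = 0"
    by (simp add: yw(3) inner_add_left)
  then show thesis
    using yw(1,3) that by auto
qed

section \<open>The total cost and the saddle function\<close>

lemma bounded_linear_block: "bounded_linear (\<lambda>x. block x i)"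
  by (rule linear_conv_bounded_linear[THEN iffD1], rule linearI)
     (simp_all add: block_def vec_eq_iff)

lemma locally_lipschitz_total_cost:
  assumes "\<And>i. locally_lipschitz (f i)"
  shows "locally_lipschitz (total_cost f)"
  unfolding total_cost_def[abs_def]
  by (intro locally_lipschitz_sum locally_lipschitz_compose[OF assms]
      locally_lipschitz_bounded_linear bounded_linear_block)

lemma convex_on_total_cost:
  assumes "\<And>i. convex_on UNIV (f i)"
  shows "convex_on UNIV (total_cost f)"
proof (rule convex_onI)
  fix t :: real and x y assume t: "0 < t" "t < 1"
  have "f i (block ((1 - t) *\<^sub>R x + t *\<^sub>R y) i)
      \<le> (1 - t) * f i (block x i) + t * f i (block y i)" for i
  proof -
    interpret bounded_linear "\<lambda>x. block x i"
      by (rule bounded_linear_block)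
    show ?thesis
      using convex_onD[OF assms, of t "block x i" "block y i"] t by (simp add: add scaleR)
  qed
  then show "total_cost f ((1 - t) *\<^sub>R x + t *\<^sub>R y)
      \<le> (1 - t) * total_cost f x + t * total_cost f y"
    by (simp add: total_cost_def sum_distrib_left flip: sum.distrib) (rule sum_mono)
qed simp

lemma bounded_bilinear_inner_matrix_vector:
  fixes M :: "real^'n::finite^'m::finite"
  shows "bounded_bilinear (\<lambda>x z. x \<bullet> (M *v z))"
  by (rule bounded_bilinear.comp[OF bounded_bilinear_inner bounded_linear_ident
        matrix_vector_mul_bounded_linear])

lemma locally_lipschitz_saddle_function:
  fixes f :: "'n::finite \<Rightarrow> real^'d::finite \<Rightarrow> real"
  assumes "\<And>i. locally_lipschitz (f i)"
  shows "locally_lipschitz (\<lambda>(x, z). saddle_function A f x z)"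
proof -
  let ?L = "bold_laplacian A :: real^('n \<times> 'd)^('n \<times> 'd)"
  let ?B = "\<lambda>x z. x \<bullet> (?L *v z)"
  note B = locally_lipschitz_bounded_bilinear[OF bounded_bilinear_inner_matrix_vector]
  have 1: "locally_lipschitz (\<lambda>p :: (real^('n \<times> 'd)) \<times> (real^('n \<times> 'd)). total_cost f (fst p))"
    by (rule locally_lipschitz_compose[where f = fst])
       (rule locally_lipschitz_total_cost[OF assms]
          locally_lipschitz_bounded_linear[OF bounded_linear_fst])+
  have 2: "locally_lipschitz (\<lambda>p. ?B (fst p) (snd p))"
    using B[of ?L] by (simp add: case_prod_unfold)
  have "bounded_linear (\<lambda>p :: (real^('n \<times> 'd)) \<times> (real^('n \<times> 'd)).
      (fst p, (1/2) *\<^sub>R fst p))"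
    by (intro bounded_linear_Pair bounded_linear_fst
        bounded_linear_compose[OF bounded_linear_scaleR_right])
  from locally_lipschitz_compose[OF B[of ?L] locally_lipschitz_bounded_linear[OF this]]
  have 3: "locally_lipschitz (\<lambda>p :: (real^('n \<times> 'd)) \<times> (real^('n \<times> 'd)).
      1/2 * ?B (fst p) (fst p))"
    by (simp add: case_prod_unfold matrix_vector_mult_scaleR)
  show ?thesis
    using locally_lipschitz_add[OF locally_lipschitz_add[OF 1 2] 3]
    by (simp add: saddle_function_def case_prod_unfold)
qed

lemma convex_on_saddle_function:
  assumes "weighted_digraph E A" and "weight_balanced A" and "\<And>i. convex_on UNIV (f i)"
  shows "convex_on UNIV (\<lambda>x. saddle_function A f x z)"
proof -
  have "convex_on UNIV (\<lambda>x. x \<bullet> (bold_laplacian A *v z))"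
    by (rule convex_onI) (simp_all add: inner_add_left)
  moreover have "convex_on UNIV (\<lambda>x. 1/2 * (x \<bullet> (bold_laplacian A *v x)))"
    by (intro convex_on_cmul convex_on_quadratic_form[OF bounded_bilinear_inner_matrix_vector]
        inner_bold_laplacian_nonneg[OF assms(1,2)]) simp
  ultimately show ?thesis
    unfolding saddle_function_def
    by (intro convex_on_add convex_on_total_cost[OF assms(3)])
qed

lemma affine_saddle_function: "affine_function (\<lambda>z. saddle_function A f x z)"
  unfolding affine_function_def saddle_function_def
  by (rule linearI)
     (simp_all add: matrix_vector_right_distrib inner_add_right matrix_vector_mult_scaleR)

lemma saddle_function_consensus:
  assumes "weight_balanced A" and "x \<in> consensus"
  shows "saddle_function A f x z = total_cost f x"
  by (simp add: saddle_function_def inner_consensus_bold_laplacian[OF assms])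

theorem mainTheorem3:
  fixes E :: "('n::finite \<times> 'n) set"
    and A :: "real^'n^'n"
    and f :: "'n \<Rightarrow> real^'d::finite \<Rightarrow> real"
  assumes "weighted_digraph E A"
    and "strongly_connected E"
    and "weight_balanced A"
    and "\<And>i. locally_lipschitz (f i)"
    and "\<And>i. convex_on UNIV (f i)"
  shows "locally_lipschitz (\<lambda>(x, z). saddle_function A f x z) \<and>
    (\<forall>z. convex_on UNIV (\<lambda>x. saddle_function A f x z)) \<and>
    (\<forall>x. affine_function (\<lambda>z. saddle_function A f x z)) \<and>
    (\<forall>xs zs. saddle_point (saddle_function A f) xs zs \<longrightarrow>
      (\<forall>a :: real^'d. saddle_point (saddle_function A f) xs (zs + (1::real^'n) \<otimes>\<^sub>V a))) \<and>
    (\<forall>xs zs. saddle_point (saddle_function A f) xs zs \<longrightarrow> solves_problem A f xs) \<and>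
    (\<forall>xs. solves_problem A f xs \<longrightarrow>
      (\<exists>zs. bold_laplacian A *v zs \<in> uminus ` generalized_gradient (total_cost f) xs \<and>
        saddle_point (saddle_function A f) xs zs))"
proof (intro conjI allI impI)
  note G = assms(1) and conn = assms(2) and bal = assms(3)
  let ?L = "bold_laplacian A :: real^('n \<times> 'd)^('n \<times> 'd)"
  let ?F = "saddle_function A f"
  have ker: "?L *v x = 0 \<longleftrightarrow> x \<in> consensus" for x
    using bold_laplacian_consensus consensus_of_quadratic_form_zero[OF G conn bal]
    by (metis inner_zero_right)
  show "locally_lipschitz (\<lambda>(x, z). ?F x z)"
    by (rule locally_lipschitz_saddle_function[OF assms(4)])
  show "convex_on UNIV (\<lambda>x. ?F x z)" for z
    by (rule convex_on_saddle_function[OF G bal assms(5)])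
  show "affine_function (?F x)" for x
    by (rule affine_saddle_function)
  show "saddle_point ?F xs (zs + 1 \<otimes>\<^sub>V a)" if "saddle_point ?F xs zs" for xs zs a
  proof -
    have "?L *v (1 \<otimes>\<^sub>V a) = 0"
      by (simp add: ker consensus_def)
    then have "?F x (zs + 1 \<otimes>\<^sub>V a) = ?F x zs" for x
      by (simp add: saddle_function_def matrix_vector_right_distrib)
    with that show ?thesis
      by (simp add: saddle_point_def)
  qed
  show "solves_problem A f xs" if saddle: "saddle_point ?F xs zs" for xs zs
  proof -
    have max: "xs \<bullet> (?L *v w) \<le> 0" for w
    proof -
      have "?F xs (zs + w) \<le> ?F xs zs"
        using saddle by (simp add: saddle_point_def)
      then show ?thesis
        by (simp add: saddle_function_def matrix_vector_right_distrib inner_add_right)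
    qed
    then have "xs \<bullet> (?L *v xs) = 0"
      using inner_bold_laplacian_nonneg[OF G bal] by (intro antisym)
    then have xs: "xs \<in> consensus"
      by (rule consensus_of_quadratic_form_zero[OF G conn bal])
    have "total_cost f xs \<le> total_cost f x" if "x \<in> consensus" for x
      using saddle saddle_function_consensus[OF bal] xs that
      unfolding saddle_point_def by metis
    with xs show ?thesis
      by (auto simp: solves_problem_def is_arg_min_linorder ker)
  qed
  show "\<exists>zs. ?L *v zs \<in> uminus ` generalized_gradient (total_cost f) xs \<and> saddle_point ?F xs zs"
    if sol: "solves_problem A f xs" for xs
  proof -
    have xs: "xs \<in> consensus" and min: "\<And>x. x \<in> consensus \<Longrightarrow> total_cost f xs \<le> total_cost f x"
      using sol by (auto simp: solves_problem_def is_arg_min_linorder ker)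
    obtain g where perp: "\<And>s. s \<in> consensus \<Longrightarrow> g \<bullet> s = 0"
      and sub: "\<And>y. total_cost f y \<ge> total_cost f xs + g \<bullet> (y - xs)"
      using subgradient_orthogonal_to_subspace[OF convex_on_total_cost[OF assms(5)]
          subspace_consensus min[OF subspace_add[OF subspace_consensus xs]]] by blast
    obtain zs where zs: "?L *v zs = - g"
      using orthogonal_consensus_in_range[OF G conn bal, of "- g"] perp by auto
    have "g \<in> generalized_gradient (total_cost f) xs"
      using sub by (simp add: generalized_gradient_convex[OF convex_on_total_cost[OF assms(5)]
            locally_lipschitz_total_cost[OF assms(4)]])
    moreover have "?F xs zs \<le> ?F x zs" for x
    proof -
      have "total_cost f xs \<le> total_cost f x - x \<bullet> g"
        using sub[of x] perp[OF xs] by (simp add: inner_diff_right inner_commute)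
      also have "\<dots> \<le> ?F x zs"
        using inner_bold_laplacian_nonneg[OF G bal, of x] by (simp add: saddle_function_def zs)
      finally show ?thesis
        by (simp add: saddle_function_consensus[OF bal xs])
    qed
    ultimately show ?thesis
      by (intro exI[of _ zs])
         (auto simp: zs saddle_point_def saddle_function_consensus[OF bal xs])
  qed
qed

end
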